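(* Let $s\in(0,1)$, $\sigma\in(0,1)$, $\beta>0$, $\epsilon>0$. Consider the $hp$-discretization space $V_{h,M}=V_h\otimes V_M$ built on the geometric mesh of $(0,Y)$ with parameter $\sigma$ and a linear degree vector $p\in\mathbb N^M$ with slope $\beta$, with parameters chosen to achieve the order of convergence $\|y^{\alpha/2}\nabla(u-u_h)\|_{L^2(C)}\le c\,h_\Omega\|\mathfrak f\|_{\mathbb H^{1-s}(\Omega)}$ (for $\mathfrak f\in \mathbb H^{1-s}(\Omega)$), namely $$2\,\frac{(1+\epsilon)|\ln h_\Omega|}{\min(s,\beta b)\,|\ln\sigma|}\ge M\ge\frac{(1+\epsilon)|\ln h_\Omega|}{\min(s,\beta b)\,|\ln\sigma|},\qquad 2\max\Bigl(\frac{2|\ln h_\Omega|}{\sqrt{\lambda_1}},1\Bigr)\ge Y\ge\max\Bigl(\frac{2|\ln h_\Omega|}{\sqrt{\lambda_1}},1\Bigr),$$ where $b>0$ is a constant depending only on $\sigma$. Then the total number $\mathcal N_{\Omega,Y}$ of degrees of freedom in $V_{h,M}$ satisfies $$\mathcal N_{\Omega,Y}=O\bigl(\mathcal N_\Omega(\ln\mathcal N_\Omega)^2\bigr)\quad\text{as }h_\Omega\to0,$$ where $\mathcal N_\Omega$ is the number of degrees of freedom in $V_h$.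
   Context: $d\in\{1,2,3\}$, $\Omega\subset\mathbb R^d$ is a bounded, convex, polygonal or polyhedral domain (an interval if $d=1$); $0<\lambda_1\le\lambda_2\le\cdots$ are the eigenvalues of $-\Delta$ on $\Omega$ with homogeneous Dirichlet conditions, $(\varphi_k)$ corresponding $L^2(\Omega)$-orthonormal eigenfunctions, and for $t\ge0$ $\mathbb H^t(\Omega)=\{v\in L^2(\Omega):\|v\|_{\mathbb H^t(\Omega)}^2=\sum_k\lambda_k^t(\int_\Omega v\varphi_k\,dx)^2<\infty\}$ with dual $\mathbb H^{-t}(\Omega)$. Extended problem (only for the meaning of the convergence order): $\alpha=1-2s$, $d_s=2^\alpha\Gamma(1-s)/\Gamma(s)$, $C=\Omega\times(0,\infty)$, $C_Y=\Omega\times(0,Y)$; $\mathring H^1_L(C,y^\alpha)$ is the space of $v$ on $C$ with $y^{\alpha/2}v,y^{\alpha/2}\nabla v\in L^2(C)$ and $v=0$ on $\partial\Omega\times[0,\infty)$; $\operatorname{tr}_\Omega v=v(\cdot,0)$. $u\in\mathring H^1_L(C,y^\alpha)$ solves $\int_C y^\alpha\nabla u\cdot\nabla v\,d(x,y)=d_s\langle\mathfrak f,\operatorname{tr}_\Omega v\rangle$ for all $v\in\mathring H^1_L(C,y^\alpha)$, and $u_h\in V_{h,M}$ (extended by zero to $C$) solves $\int_{C_Y}y^\alpha\nabla u_h\cdot\nabla v_h\,d(x,y)=d_s\langle\mathfrak f,\operatorname{tr}_\Omega v_h\rangle$ for all $v_h\in V_{h,M}$. Discretization. $\mathcal T_\Omega$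 belongs to a family of conforming, quasi-uniform triangulations of $\Omega$, admissible in the sense of Ciarlet, each element $K$ being isoparametrically equivalent to the unit simplex or unit cube in $\mathbb R^d$; $h_\Omega=\max_K\operatorname{diam}K\le\frac12$. $V_h$ is the space of continuous functions on $\overline\Omega$ vanishing on $\partial\Omega$ whose restriction to each $K$ is a polynomial of degree at most $1$ (simplex), resp. of degree at most $1$ in each variable (cube); $\mathcal N_\Omega=\dim V_h$, and $\mathcal N_\Omega=O(h_\Omega^{-d})$ with $h_\Omega^{-d}=O(\mathcal N_\Omega)$ as $h_\Omega\to0$. The geometric mesh of $(0,Y)$ has nodes $y_0=0$, $y_m=\sigma^{M-m}Y$ ($m=1,\dots,M$); $I_m=[y_{m-1},y_m]$, $h_m=|I_m|$. A linear degree vector with slope $\beta$ is $p=(p_1,\dots,p_M)\in\mathbb N^M$, $\mathbb N=\{1,2,\dots\}$, such that for a constant $c_p\ge1$ (fixed, independent of $m,M,Y,h_\Omega$) $1+\beta\ln\frac{h_m}{h_1}\le p_m\le1+c_p\beta\ln\frac{h_m}{h_1}$ for all $m$. $V_M=\{\xi\in C^0([0,Y]):\xi|_{I_m}\text{ polynomial of degree}\le p_m,\ \xi(Y)=0\}$, and $V_{h,M}=V_h\otimes V_M$. The number of degrees of freedom is the dimension of the space. *)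

theory Defs
  imports
    "HOL-Analysis.Analysis"
    "HOL-Library.Function_Algebras"
    "HOL-Library.Landau_Symbols"
begin

section \<open>Dirichlet eigenvalues of the Laplacian\<close>

definition convex_polytopal_domain :: "(real^'n) set \<Rightarrow> bool" where
  "convex_polytopal_domain \<Omega> \<longleftrightarrow>
     open \<Omega> \<and> \<Omega> \<noteq> {} \<and> bounded \<Omega> \<and> convex \<Omega> \<and> polytope (closure \<Omega>)"

definition grad :: "(real^'n \<Rightarrow> real) \<Rightarrow> real^'n \<Rightarrow> real^'n" where
  "grad f x = (\<chi> i. frechet_derivative f (at x) (axis i 1))"

primrec k_times_differentiable :: "nat \<Rightarrow> (real^'n \<Rightarrow> real) \<Rightarrow> bool" where
  "k_times_differentiable 0 f \<longleftrightarrow> continuous_on UNIV f"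
| "k_times_differentiable (Suc k) f \<longleftrightarrow>
     (\<forall>x. f differentiable at x) \<and> (\<forall>i. k_times_differentiable k (\<lambda>x. grad f x $ i))"

definition test_function :: "(real^'n) set \<Rightarrow> (real^'n \<Rightarrow> real) \<Rightarrow> bool" where
  "test_function \<Omega> f \<longleftrightarrow> (\<forall>k. k_times_differentiable k f) \<and>
     compact (closure {x. f x \<noteq> 0}) \<and> closure {x. f x \<noteq> 0} \<subseteq> \<Omega>"

definition square_integrable ::
    "(real^'n) set \<Rightarrow> (real^'n \<Rightarrow> 'b::euclidean_space) \<Rightarrow> bool" where
  "square_integrable \<Omega> f \<longleftrightarrow> f \<in> borel_measurable (lebesgue_on \<Omega>) \<and>
     integrable (lebesgue_on \<Omega>) (\<lambda>x. (norm (f x))\<^sup>2)"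

(* u lies in H^1_0 (the closure of the test functions in the H^1 norm), with weak gradient g *)
definition H10 :: "(real^'n) set \<Rightarrow> (real^'n \<Rightarrow> real) \<Rightarrow> (real^'n \<Rightarrow> real^'n) \<Rightarrow> bool" where
  "H10 \<Omega> u g \<longleftrightarrow> square_integrable \<Omega> u \<and> square_integrable \<Omega> g \<and>
     (\<exists>\<psi> :: nat \<Rightarrow> real^'n \<Rightarrow> real. (\<forall>n. test_function \<Omega> (\<psi> n)) \<and>
        (\<lambda>n. integral\<^sup>L (lebesgue_on \<Omega>) (\<lambda>x. (\<psi> n x - u x)\<^sup>2)) \<longlonglongrightarrow> 0 \<and>
        (\<lambda>n. integral\<^sup>L (lebesgue_on \<Omega>) (\<lambda>x. (norm (grad (\<psi> n) x - g x))\<^sup>2)) \<longlonglongrightarrow> 0)"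

(* Weak form of - Laplace u = \<mu> u in \<Omega>, u = 0 on the boundary. *)
definition dirichlet_eigenpair :: "(real^'n) set \<Rightarrow> real \<Rightarrow> (real^'n \<Rightarrow> real) \<Rightarrow> bool" where
  "dirichlet_eigenpair \<Omega> \<mu> u \<longleftrightarrow>
     \<not> (AE x in lebesgue_on \<Omega>. u x = 0) \<and>
     (\<exists>g. H10 \<Omega> u g \<and>
        (\<forall>v w. H10 \<Omega> v w \<longrightarrow>
           integral\<^sup>L (lebesgue_on \<Omega>) (\<lambda>x. g x \<bullet> w x) =
           \<mu> * integral\<^sup>L (lebesgue_on \<Omega>) (\<lambda>x. u x * v x)))"

(* The sequences are indexed from 1, and their values at 0 are irrelevant.  Completeness of
   the eigenfunctions is what makes lam list all eigenvalues, with multiplicity. *)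
definition dirichlet_eigensystem ::
    "(real^'n) set \<Rightarrow> (nat \<Rightarrow> real) \<Rightarrow> (nat \<Rightarrow> real^'n \<Rightarrow> real) \<Rightarrow> bool" where
  "dirichlet_eigensystem \<Omega> lam \<phi> \<longleftrightarrow>
     0 < lam 1 \<and> mono_on {1..} lam \<and>
     (\<forall>k\<ge>1. dirichlet_eigenpair \<Omega> (lam k) (\<phi> k)) \<and>
     (\<forall>j\<ge>1. \<forall>k\<ge>1. integral\<^sup>L (lebesgue_on \<Omega>) (\<lambda>x. \<phi> j x * \<phi> k x) = (if j = k then 1 else 0)) \<and>
     (\<forall>u. square_integrable \<Omega> u \<and>
          (\<forall>k\<ge>1. integral\<^sup>L (lebesgue_on \<Omega>) (\<lambda>x. u x * \<phi> k x) = 0) \<longrightarrow>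
          (AE x in lebesgue_on \<Omega>. u x = 0))"


section \<open>Triangulations\<close>

definition unit_simplex :: "(real^'n) set" where
  "unit_simplex = convex hull (insert 0 Basis)"

definition unit_cube :: "(real^'n) set" where
  "unit_cube = cbox 0 1"

(* polynomials of total degree at most 1 *)
definition P1 :: "(real^'n \<Rightarrow> real) set" where
  "P1 = {q. \<exists>a c. \<forall>x. q x = a + c \<bullet> x}"

(* polynomials of degree at most 1 in each variable: the monomials are the products of the
   coordinates in a set S *)
definition Q1 :: "(real^'n \<Rightarrow> real) set" where
  "Q1 = {q. \<exists>c :: 'n set \<Rightarrow> real. \<forall>x. q x = (\<Sum>S\<in>UNIV. c S * (\<Prod>i\<in>S. x $ i))}"

(* F is an isoparametric element map from the reference element R onto K, i.e. a
   diffeomorphism with components in the polynomial space P of the reference element *)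
definition element_map ::
    "(real^'n) set \<Rightarrow> (real^'n \<Rightarrow> real) set \<Rightarrow> (real^'n \<Rightarrow> real^'n) \<Rightarrow> (real^'n) set \<Rightarrow> bool" where
  "element_map R P F K \<longleftrightarrow>
     (\<forall>i. (\<lambda>x. F x $ i) \<in> P) \<and> inj_on F R \<and>
     (\<forall>x\<in>R. \<exists>F'. (F has_derivative F') (at x) \<and> bij F') \<and> F ` R = K"

definition simplex_element :: "(real^'n) set \<Rightarrow> bool" where
  "simplex_element K \<longleftrightarrow> (\<exists>F. element_map unit_simplex P1 F K)"

definition cube_element :: "(real^'n) set \<Rightarrow> bool" where
  "cube_element K \<longleftrightarrow> (\<exists>F. element_map unit_cube Q1 F K)"

(* As for face_of, the empty set and K itself are faces of K. *)
definition element_face :: "(real^'n) set \<Rightarrow> (real^'n) set \<Rightarrow> bool" where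
  "element_face S K \<longleftrightarrow>
     (\<exists>F f. element_map unit_simplex P1 F K \<and> f face_of unit_simplex \<and> S = F ` f) \<or>
     (\<exists>F f. element_map unit_cube Q1 F K \<and> f face_of unit_cube \<and> S = F ` f)"

definition fe_triangulation :: "(real^'n) set \<Rightarrow> (real^'n) set set \<Rightarrow> bool" where
  "fe_triangulation \<Omega> T \<longleftrightarrow>
     finite T \<and> \<Union>T = closure \<Omega> \<and>
     (\<forall>K\<in>T. simplex_element K \<or> cube_element K) \<and>
     (\<forall>K\<in>T. \<forall>K'\<in>T. K \<noteq> K' \<longrightarrow> interior K \<inter> interior K' = {}) \<and>
     (\<forall>K\<in>T. \<forall>K'\<in>T. element_face (K \<inter> K') K \<and> element_face (K \<inter> K') K')"

definition mesh_size :: "(real^'n) set set \<Rightarrow> real" where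
  "mesh_size T = Max (diameter ` T)"

(* supremum of the diameters of the balls contained in K *)
definition inball_diameter :: "(real^'n) set \<Rightarrow> real" where
  "inball_diameter K = Sup {2 * r | r x. 0 \<le> r \<and> cball x r \<subseteq> K}"

(* shape regularity, and all elements of one triangulation of comparable size, with
   constants uniform over the family *)
definition quasi_uniform :: "('i \<Rightarrow> (real^'n) set set) \<Rightarrow> bool" where
  "quasi_uniform T \<longleftrightarrow>
     (\<exists>\<kappa>>0. \<forall>i. \<forall>K\<in>T i. diameter K \<le> \<kappa> * inball_diameter K \<and> mesh_size (T i) \<le> \<kappa> * diameter K)"


section \<open>Discrete spaces\<close>

global_interpretation fun_space: vector_space "\<lambda>(c::real) (f::'a \<Rightarrow> real) x. c * f x"
  by unfold_locales (auto simp: algebra_simps fun_eq_iff)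

(* Functions on the closure of \<Omega> vanishing on the boundary are represented by their
   extension by zero, so that distinct members are distinct functions. *)
definition fe_space :: "(real^'n) set \<Rightarrow> (real^'n) set set \<Rightarrow> (real^'n \<Rightarrow> real) set" where
  "fe_space \<Omega> T =
     {v. continuous_on (closure \<Omega>) v \<and> (\<forall>x. x \<notin> \<Omega> \<longrightarrow> v x = 0) \<and>
         (\<forall>K\<in>T. (simplex_element K \<longrightarrow> (\<exists>q\<in>P1. \<forall>x\<in>K. v x = q x)) \<and>
                 (cube_element K \<longrightarrow> (\<exists>q\<in>Q1. \<forall>x\<in>K. v x = q x)))}"

definition geometric_node :: "real \<Rightarrow> nat \<Rightarrow> real \<Rightarrow> nat \<Rightarrow> real" where
  "geometric_node \<sigma> M Y m = (if m = 0 then 0 else \<sigma> ^ (M - m) * Y)"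

definition mesh_width :: "real \<Rightarrow> nat \<Rightarrow> real \<Rightarrow> nat \<Rightarrow> real" where
  "mesh_width \<sigma> M Y m = geometric_node \<sigma> M Y m - geometric_node \<sigma> M Y (m - 1)"

(* Only the entries p 1, ..., p M of the degree vector are relevant. *)
definition linear_degree_vector ::
    "real \<Rightarrow> real \<Rightarrow> real \<Rightarrow> nat \<Rightarrow> real \<Rightarrow> (nat \<Rightarrow> nat) \<Rightarrow> bool" where
  "linear_degree_vector c \<beta> \<sigma> M Y p \<longleftrightarrow>
     (\<forall>m\<in>{1..M}. 1 \<le> p m \<and>
        1 + \<beta> * ln (mesh_width \<sigma> M Y m / mesh_width \<sigma> M Y 1) \<le> real (p m) \<and>
        real (p m) \<le> 1 + c * \<beta> * ln (mesh_width \<sigma> M Y m / mesh_width \<sigma> M Y 1))"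

(* functions on [0,Y], extended by zero to the real line *)
definition hp_space :: "real \<Rightarrow> nat \<Rightarrow> real \<Rightarrow> (nat \<Rightarrow> nat) \<Rightarrow> (real \<Rightarrow> real) set" where
  "hp_space \<sigma> M Y p =
     {\<xi>. continuous_on {0..Y} \<xi> \<and> \<xi> Y = 0 \<and> (\<forall>y. y \<notin> {0..Y} \<longrightarrow> \<xi> y = 0) \<and>
         (\<forall>m\<in>{1..M}. \<exists>q :: real poly. degree q \<le> p m \<and>
            (\<forall>y\<in>{geometric_node \<sigma> M Y (m - 1)..geometric_node \<sigma> M Y m}. \<xi> y = poly q y))}"

definition tensor_space ::
    "('a \<Rightarrow> real) set \<Rightarrow> ('b \<Rightarrow> real) set \<Rightarrow> ('a \<times> 'b \<Rightarrow> real) set" where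
  "tensor_space V W = fun_space.span {\<lambda>(x, y). v x * w y | v w. v \<in> V \<and> w \<in> W}"

end

theory Submission
  imports Defs
begin

text \<open>
  The dimension of a tensor product is at most the product of the dimensions, so all that is left
  is to show that the space on \<open>(0, Y)\<close> has dimension \<open>O((ln N)\<^sup>2)\<close>, where \<open>N = dim V\<^sub>h\<close>.

  On element \<open>m\<close> a member of that space has \<open>p\<^sub>m + 1\<close> coefficients, which gives the spanning set of
  \<open>hp_space_subset_span\<close>. The quotient of mesh widths \<open>h\<^sub>m / h\<^sub>1\<close> is \<open>(1 - \<sigma>) \<sigma>\<^bsup>1 - m\<^esup>\<close> for
  \<open>m \<ge> 2\<close>; the length \<open>Y\<close> cancels. A linear degree vector therefore has \<open>p\<^sub>m = O(M)\<close>, and the sum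
  of all \<open>p\<^sub>m + 1\<close> is \<open>O(M\<^sup>2)\<close> (\<open>linear_degree_sum_le\<close>). With \<open>M = O(\<bar>ln h\<bar>)\<close>, what remains is
  \<open>\<bar>ln h\<bar> = O(ln N)\<close>, which follows from \<open>h\<^sup>-\<^sup>d = O(N)\<close> (\<open>eventually_abs_ln_le_ln\<close>).

  The relation \<open>h\<^sup>-\<^sup>d = O(N)\<close> serves a second purpose: it forces \<open>N > 0\<close> for small \<open>h\<close>, and as an
  infinite-dimensional space has dimension 0 by convention, this makes \<open>V\<^sub>h\<close> finite-dimensional.
\<close>

section \<open>Dimension of a tensor product space\<close>

lemma fun_scale_sum_in_span:
  fixes g :: "'k \<Rightarrow> 'a \<Rightarrow> real"
  assumes "\<And>k. k \<in> I \<Longrightarrow> g k \<in> fun_space.span A"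
  shows "(\<lambda>x. \<Sum>k\<in>I. c k * g k x) \<in> fun_space.span A"
proof -
  have "(\<lambda>x. \<Sum>k\<in>I. c k * g k x) = (\<Sum>k\<in>I. (\<lambda>x. c k * g k x))"
    by (induction I rule: infinite_finite_induct) (auto simp: fun_eq_iff)
  also have "\<dots> \<in> fun_space.span A"
    by (intro fun_space.span_sum fun_space.span_scale assms)
  finally show ?thesis .
qed

lemma product_in_span_of_products:
  fixes v :: "'a \<Rightarrow> real" and w :: "'b \<Rightarrow> real"
  assumes v: "v \<in> fun_space.span B" and w: "w \<in> fun_space.span A"
  shows "(\<lambda>(x, y). v x * w y) \<in> fun_space.span ((\<lambda>(f, g) (x, y). f x * g y) ` (B \<times> A))"
    (is "_ \<in> fun_space.span ?P")
proof -
  have one: "(\<lambda>(x, y). f x * w y) \<in> fun_space.span ?P" if f: "f \<in> B" for f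
    using w
  proof (induction rule: fun_space.span_induct_alt)
    case base
    have "(\<lambda>(x::'a, y::'b). f x * (0::'b \<Rightarrow> real) y) = 0" by (auto simp: fun_eq_iff)
    then show ?case by (simp only: fun_space.span_zero)
  next
    case (step c g y)
    have "(\<lambda>(x, y). f x * g y) \<in> fun_space.span ?P"
      using f step(1) by (intro fun_space.span_base) force
    then have "(\<lambda>z. c * (\<lambda>(x, y). f x * g y) z) + (\<lambda>(x, z). f x * y z) \<in> fun_space.span ?P"
      by (intro fun_space.span_add fun_space.span_scale step(2))
    also have "(\<lambda>z. c * (\<lambda>(x, y). f x * g y) z) + (\<lambda>(x, z). f x * y z)
        = (\<lambda>(x, z). f x * ((\<lambda>x. c * g x) + y) z)"
      by (auto simp: fun_eq_iff algebra_simps)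
    finally show ?case .
  qed
  show ?thesis using v
  proof (induction rule: fun_space.span_induct_alt)
    case base
    have "(\<lambda>(x::'a, y::'b). (0::'a \<Rightarrow> real) x * w y) = 0" by (auto simp: fun_eq_iff)
    then show ?case by (simp only: fun_space.span_zero)
  next
    case (step c f v')
    have "(\<lambda>z. c * (\<lambda>(x, y). f x * w y) z) + (\<lambda>(x, z). v' x * w z) \<in> fun_space.span ?P"
      by (intro fun_space.span_add fun_space.span_scale one step)
    also have "(\<lambda>z. c * (\<lambda>(x, y). f x * w y) z) + (\<lambda>(x, z). v' x * w z)
        = (\<lambda>(x, z). ((\<lambda>x. c * f x) + v') x * w z)"
      by (auto simp: fun_eq_iff algebra_simps)
    finally show ?case .
  qed
qed

text \<open>
  The dimension of an infinite-dimensional space is 0 by convention, so a positive dimension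
  of \<open>V\<close> provides a finite basis, and products of its members with those of \<open>A\<close> span the
  tensor space.
\<close>

lemma dim_tensor_space_le:
  fixes V :: "('a \<Rightarrow> real) set" and W :: "('b \<Rightarrow> real) set"
  assumes V: "fun_space.dim V > 0" and A: "finite A" and W: "W \<subseteq> fun_space.span A"
  shows "fun_space.dim (tensor_space V W) \<le> fun_space.dim V * card A"
proof -
  obtain B where B: "V \<subseteq> fun_space.span B" "card B = fun_space.dim V"
    using fun_space.basis_exists[of V] by metis
  then have finB: "finite B" using V by (metis card_gt_0_iff)
  let ?P = "(\<lambda>(f, g) (x, y). f x * g y) ` (B \<times> A) :: ('a \<times> 'b \<Rightarrow> real) set"
  have "{\<lambda>(x, y). v x * w y | v w. v \<in> V \<and> w \<in> W} \<subseteq> fun_space.span ?P"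
    using product_in_span_of_products B(1) W by blast
  then have "fun_space.dim (tensor_space V W) \<le> card ?P"
    unfolding tensor_space_def fun_space.dim_span
    by (rule fun_space.dim_le_card) (use finB A in auto)
  also have "\<dots> \<le> card (B \<times> A)" by (intro card_image_le) (use finB A in auto)
  also have "\<dots> = fun_space.dim V * card A" using B(2) by (simp add: card_cartesian_product)
  finally show ?thesis .
qed

section \<open>Degrees of freedom on the geometric mesh\<close>

definition truncated_monomial :: "real \<Rightarrow> nat \<Rightarrow> real \<Rightarrow> nat \<Rightarrow> nat \<Rightarrow> real \<Rightarrow> real" where
  "truncated_monomial \<sigma> M Y m k y =
     (if geometric_node \<sigma> M Y (m - 1) \<le> y \<and> y < geometric_node \<sigma> M Y m then y ^ k else 0)"

lemma geometric_node_mono: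
  assumes \<sigma>: "0 < \<sigma>" "\<sigma> < 1" and Y: "0 \<le> Y" and mn: "m \<le> n"
  shows "geometric_node \<sigma> M Y m \<le> geometric_node \<sigma> M Y n"
proof -
  have "\<sigma> ^ (M - m) \<le> \<sigma> ^ (M - n)"
    using \<sigma> mn by (intro power_decreasing) auto
  then show ?thesis using \<sigma> Y mn by (auto simp: geometric_node_def intro: mult_right_mono)
qed

text \<open>
  The elements of the mesh are taken half-open, closed on the left. They then partition
  \<open>[0, Y)\<close>, and at \<open>Y\<close> every truncated monomial vanishes, as does every function of the space.
  With closed elements the spanning functions would overlap at the nodes.
\<close>

lemma hp_space_subset_span:
  assumes \<sigma>: "0 < \<sigma>" "\<sigma> < 1" and Y: "0 \<le> Y" and M: "1 \<le> M"
  shows "hp_space \<sigma> M Y p \<subseteq> fun_space.span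
           ((\<lambda>(m, k). truncated_monomial \<sigma> M Y m k) ` (SIGMA m:{1..M}. {..p m}))"
    (is "_ \<subseteq> fun_space.span ?A")
proof
  fix \<xi> assume \<xi>: "\<xi> \<in> hp_space \<sigma> M Y p"
  let ?y = "geometric_node \<sigma> M Y"
  have end_nodes: "?y 0 = 0" "?y M = Y" using M by (auto simp: geometric_node_def)
  obtain q where deg: "degree (q m) \<le> p m"
    and q: "\<forall>y\<in>{?y (m - 1)..?y m}. \<xi> y = poly (q m) y"
    if "m \<in> {1..M}" for m
    using \<xi> unfolding hp_space_def mem_Collect_eq by metis
  let ?S = "SIGMA m:{1..M}. {..p m}"
  \<comment> \<open>At each point of \<open>[0, Y)\<close> exactly one half-open element contributes to the sum over \<open>m\<close>.\<close>
  have expand: "\<xi> y = (\<Sum>(m, k)\<in>?S. coeff (q m) k * truncated_monomial \<sigma> M Y m k y)" for y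
  proof -
    have "(\<Sum>(m, k)\<in>?S. coeff (q m) k * truncated_monomial \<sigma> M Y m k y)
        = (\<Sum>m\<in>{1..M}. \<Sum>k\<le>p m. coeff (q m) k * truncated_monomial \<sigma> M Y m k y)"
      by (subst sum.Sigma) auto
    also have "\<dots> = (\<Sum>m\<in>{1..M}. if ?y (m - 1) \<le> y \<and> y < ?y m then \<xi> y else 0)"
    proof (intro sum.cong refl)
      fix m assume m: "m \<in> {1..M}"
      have "(\<Sum>k\<le>p m. coeff (q m) k * y ^ k) = poly (q m) y"
        using deg[OF m] by (subst poly_altdef, intro sum.mono_neutral_right)
          (auto simp: coeff_eq_0)
      then show "(\<Sum>k\<le>p m. coeff (q m) k * truncated_monomial \<sigma> M Y m k y)
          = (if ?y (m - 1) \<le> y \<and> y < ?y m then \<xi> y else 0)"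
        using q[OF m] by (auto simp: truncated_monomial_def)
    qed
    also have "\<dots> = \<xi> y"
    proof (cases "0 \<le> y \<and> y < Y")
      case True
      \<comment> \<open>\<open>n\<close> is the index of the element containing \<open>y\<close>, by its right end point.\<close>
      define n where "n = (LEAST n. y < ?y n)"
      have ex: "y < ?y M" using True end_nodes by simp
      have n: "y < ?y n" "n \<le> M"
        unfolding n_def by (rule LeastI[where P = "\<lambda>n. y < ?y n", OF ex])
          (rule Least_le[where P = "\<lambda>n. y < ?y n", OF ex])
      have pre: "?y j \<le> y" if "j < n" for j
        using not_less_Least[of j "\<lambda>n. y < ?y n"] that unfolding n_def by auto
      have n1: "1 \<le> n" using n True end_nodes by (cases n) auto
      have iff: "?y (m - 1) \<le> y \<and> y < ?y m \<longleftrightarrow> m = n" if "m \<in> {1..M}" for m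
      proof
        assume a: "?y (m - 1) \<le> y \<and> y < ?y m"
        have "\<not> m < n" using pre[of m] a by auto
        moreover have "\<not> n < m"
        proof
          assume "n < m"
          then have "?y n \<le> ?y (m - 1)" by (intro geometric_node_mono \<sigma> Y) simp
          then show False using n a by simp
        qed
        ultimately show "m = n" by simp
      next
        assume "m = n"
        then show "?y (m - 1) \<le> y \<and> y < ?y m" using pre[of "n - 1"] n1 n by auto
      qed
      have "(\<Sum>m\<in>{1..M}. if ?y (m - 1) \<le> y \<and> y < ?y m then \<xi> y else 0)
          = (\<Sum>m\<in>{1..M}. if m = n then \<xi> y else 0)"
        using iff by (intro sum.cong) auto
      also have "\<dots> = \<xi> y" using n n1 by simp
      finally show ?thesis .
    next
      case False
      then have "\<xi> y = 0" using \<xi> by (cases "y = Y") (auto simp: hp_space_def)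
      then show ?thesis by (simp cong: if_cong)
    qed
    finally show ?thesis by simp
  qed
  have "(\<lambda>y. \<Sum>z\<in>?S. (case z of (m, k) \<Rightarrow> coeff (q m) k) *
             (case z of (m, k) \<Rightarrow> truncated_monomial \<sigma> M Y m k) y) \<in> fun_space.span ?A"
    by (intro fun_scale_sum_in_span fun_space.span_base imageI)
  moreover have "\<xi> = (\<lambda>y. \<Sum>z\<in>?S. (case z of (m, k) \<Rightarrow> coeff (q m) k) *
             (case z of (m, k) \<Rightarrow> truncated_monomial \<sigma> M Y m k) y)"
    using expand by (simp add: fun_eq_iff case_prod_unfold)
  ultimately show "\<xi> \<in> fun_space.span ?A" by simp
qed

text \<open>
  Since \<open>h\<^sub>m / h\<^sub>1 = (1 - \<sigma>) / \<sigma>\<^bsup>m - 1\<^esup>\<close> for \<open>m \<ge> 2\<close>, the logarithm grows linearly in \<open>m\<close>; the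
  factor \<open>1 - \<sigma>\<close> contributes a negative term.
\<close>

lemma ln_mesh_width_ratio_le:
  assumes \<sigma>: "0 < \<sigma>" "\<sigma> < 1" and Y: "0 < Y" and m: "m \<in> {1..M}"
  shows "ln (mesh_width \<sigma> M Y m / mesh_width \<sigma> M Y 1) \<le> real M * \<bar>ln \<sigma>\<bar>"
proof (cases "m = 1")
  case True
  moreover have "0 \<le> real M * \<bar>ln \<sigma>\<bar>" by simp
  ultimately show ?thesis using \<sigma> Y by (simp add: mesh_width_def geometric_node_def)
next
  case False
  have split: "\<sigma> ^ (M - 1) = \<sigma> ^ (M - m) * \<sigma> ^ (m - 1)"
    using m by (simp flip: power_add)
  have "Suc (M - m) = M - (m - 1)" using m False by auto
  then have pred: "\<sigma> ^ (M - (m - 1)) = \<sigma> * \<sigma> ^ (M - m)"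
    by (metis power_Suc)
  have "mesh_width \<sigma> M Y m = \<sigma> ^ (M - m) * (1 - \<sigma>) * Y"
    using False m pred by (simp add: mesh_width_def geometric_node_def algebra_simps)
  moreover have "mesh_width \<sigma> M Y 1 = \<sigma> ^ (M - m) * \<sigma> ^ (m - 1) * Y"
    using split by (simp add: mesh_width_def geometric_node_def)
  ultimately have ratio: "mesh_width \<sigma> M Y m / mesh_width \<sigma> M Y 1 = (1 - \<sigma>) / \<sigma> ^ (m - 1)"
    using \<sigma> Y by (simp add: field_simps)
  have "ln ((1 - \<sigma>) / \<sigma> ^ (m - 1)) = ln (1 - \<sigma>) - real (m - 1) * ln \<sigma>"
    using \<sigma> by (simp add: ln_div ln_realpow)
  also have "\<dots> \<le> real (m - 1) * \<bar>ln \<sigma>\<bar>" using \<sigma> by simp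
  also have "\<dots> \<le> real M * \<bar>ln \<sigma>\<bar>" using m by (intro mult_right_mono) auto
  finally show ?thesis using ratio by simp
qed

lemma linear_degree_sum_le:
  assumes p: "linear_degree_vector c \<beta> \<sigma> M Y p" and c: "0 \<le> c" and \<beta>: "0 \<le> \<beta>"
    and \<sigma>: "0 < \<sigma>" "\<sigma> < 1" and Y: "0 < Y" and M: "1 \<le> M"
  shows "real (\<Sum>m=1..M. p m + 1) \<le> (2 + c * \<beta> * \<bar>ln \<sigma>\<bar>) * (real M)\<^sup>2"
proof -
  have "real (\<Sum>m=1..M. p m + 1) = (\<Sum>m=1..M. real (p m) + 1)"
    by (simp add: add.commute)
  also have "\<dots> \<le> (\<Sum>m=1..M. (2 + c * \<beta> * \<bar>ln \<sigma>\<bar>) * real M)"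
  proof (intro sum_mono)
    fix m assume m: "m \<in> {1..M}"
    have "real (p m) \<le> 1 + c * \<beta> * ln (mesh_width \<sigma> M Y m / mesh_width \<sigma> M Y 1)"
      using p m by (auto simp: linear_degree_vector_def)
    also have "\<dots> \<le> 1 + c * \<beta> * (real M * \<bar>ln \<sigma>\<bar>)"
      using ln_mesh_width_ratio_le[OF \<sigma> Y m] c \<beta>
      by (intro add_left_mono mult_left_mono) auto
    finally show "real (p m) + 1 \<le> (2 + c * \<beta> * \<bar>ln \<sigma>\<bar>) * real M"
      using M by (simp add: algebra_simps)
  qed
  also have "\<dots> = (2 + c * \<beta> * \<bar>ln \<sigma>\<bar>) * (real M)\<^sup>2" by (simp add: power2_eq_square)
  finally show ?thesis .
qed

lemma dim_tensor_hp_space_le: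
  fixes V :: "('a \<Rightarrow> real) set"
  assumes V: "fun_space.dim V > 0"
    and p: "linear_degree_vector c \<beta> \<sigma> M Y p" and c: "0 \<le> c" and \<beta>: "0 \<le> \<beta>"
    and \<sigma>: "0 < \<sigma>" "\<sigma> < 1" and Y: "0 < Y" and M: "1 \<le> M"
  shows "real (fun_space.dim (tensor_space V (hp_space \<sigma> M Y p)))
           \<le> real (fun_space.dim V) * ((2 + c * \<beta> * \<bar>ln \<sigma>\<bar>) * (real M)\<^sup>2)"
proof -
  let ?S = "SIGMA m:{1..M}. {..p m}"
  let ?A = "(\<lambda>(m, k). truncated_monomial \<sigma> M Y m k) ` ?S"
  have fin: "finite ?S" by auto
  have "card ?A \<le> card ?S" using fin by (rule card_image_le)
  also have "\<dots> = (\<Sum>m=1..M. p m + 1)" by simp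
  finally have "real (card ?A) \<le> real (\<Sum>m=1..M. p m + 1)" by (simp only: of_nat_le_iff)
  also have "\<dots> \<le> (2 + c * \<beta> * \<bar>ln \<sigma>\<bar>) * (real M)\<^sup>2"
    by (rule linear_degree_sum_le[OF p c \<beta> \<sigma> Y M])
  finally have card: "real (card ?A) \<le> (2 + c * \<beta> * \<bar>ln \<sigma>\<bar>) * (real M)\<^sup>2" .
  have "fun_space.dim (tensor_space V (hp_space \<sigma> M Y p)) \<le> fun_space.dim V * card ?A"
    using fin hp_space_subset_span[OF \<sigma> less_imp_le[OF Y] M]
    by (intro dim_tensor_space_le[OF V]) auto
  then have "real (fun_space.dim (tensor_space V (hp_space \<sigma> M Y p)))
      \<le> real (fun_space.dim V) * real (card ?A)"
    by (metis of_nat_le_iff of_nat_mult)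
  also have "\<dots> \<le> real (fun_space.dim V) * ((2 + c * \<beta> * \<bar>ln \<sigma>\<bar>) * (real M)\<^sup>2)"
    using card by (intro mult_left_mono) auto
  finally show ?thesis .
qed

section \<open>Asymptotics\<close>

text \<open>
  Taking logarithms in \<open>h\<^sup>-\<^sup>d \<le> C N\<close> gives \<open>d \<bar>ln h\<bar> \<le> ln C + ln N\<close>, and the constant
  \<open>ln C\<close> is at most \<open>\<bar>ln h\<bar> / 2\<close> once \<open>h\<close> is small.
\<close>

lemma eventually_abs_ln_le_ln:
  fixes h N :: "'i \<Rightarrow> real"
  assumes h: "filterlim h (at_right 0) F" and d: "1 \<le> d" and N0: "\<And>i. 0 \<le> N i"
    and N: "(\<lambda>i. 1 / h i ^ d) \<in> O[F](N)"
  shows "\<forall>\<^sub>F i in F. 0 < N i \<and> \<bar>ln (h i)\<bar> \<le> 2 * ln (N i)"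
proof -
  obtain C where C: "C > 0" and bound: "\<forall>\<^sub>F i in F. norm (1 / h i ^ d) \<le> C * norm (N i)"
    using N by (elim landau_o.bigE)
  have small: "\<forall>\<^sub>F i in F. h i \<in> {0<..<1}"
    using h eventually_at_right_real[of 0 "1::real"] by (auto simp: filterlim_iff)
  have "filterlim (\<lambda>i. ln (h i)) at_bot F"
    by (rule filterlim_compose[OF ln_at_0 h])
  then have large: "\<forall>\<^sub>F i in F. ln (h i) \<le> - 2 * ln C"
    by (simp add: filterlim_at_bot)
  show ?thesis using bound small large
  proof eventually_elim
    case (elim i)
    have pos: "0 < 1 / h i ^ d" using elim by simp
    have le: "1 / h i ^ d \<le> C * N i" using elim N0[of i] by simp
    then have "0 < C * N i" using pos by linarith
    then have Npos: "0 < N i" using C by (simp add: zero_less_mult_iff)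
    have "\<bar>ln (h i)\<bar> = - ln (h i)" using elim by simp
    also have "\<dots> \<le> real d * - ln (h i)"
      using d elim mult_right_mono[of 1 "real d" "- ln (h i)"] by simp
    also have "\<dots> = ln (1 / h i ^ d)" using elim by (simp add: ln_div ln_realpow)
    also have "\<dots> \<le> ln (C * N i)" using le pos by (intro ln_mono) auto
    also have "\<dots> = ln C + ln (N i)" using C Npos by (simp add: ln_mult)
    finally show ?case using Npos elim by auto
  qed
qed

theorem theorem4p16:
  fixes \<Omega> :: "(real^'n) set"
    and lam :: "nat \<Rightarrow> real" and \<phi> :: "nat \<Rightarrow> real^'n \<Rightarrow> real"
    and s \<sigma> \<beta> \<epsilon> c\<^sub>p :: real and b :: "real \<Rightarrow> real"
    and T :: "'i \<Rightarrow> (real^'n) set set"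
    and M :: "'i \<Rightarrow> nat" and Y :: "'i \<Rightarrow> real" and p :: "'i \<Rightarrow> nat \<Rightarrow> nat"
  assumes dim: "CARD('n) \<in> {1, 2, 3}"
    and domain: "convex_polytopal_domain \<Omega>"
    and eigen: "dirichlet_eigensystem \<Omega> lam \<phi>"
    and s: "s \<in> {0<..<1}" and \<sigma>: "\<sigma> \<in> {0<..<1}" and \<beta>: "\<beta> > 0" and \<epsilon>: "\<epsilon> > 0"
    and b: "b \<sigma> > 0" and c\<^sub>p: "c\<^sub>p \<ge> 1"
    and triang: "\<And>i. fe_triangulation \<Omega> (T i)" and quasi: "quasi_uniform T"
    and h_le: "\<And>i. mesh_size (T i) \<le> 1 / 2"
    and N_upper: "(\<lambda>i. real (fun_space.dim (fe_space \<Omega> (T i))))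
            \<in> O[filtercomap (\<lambda>i. mesh_size (T i)) (at_right 0)](\<lambda>i. 1 / mesh_size (T i) ^ CARD('n))"
    and N_lower: "(\<lambda>i. 1 / mesh_size (T i) ^ CARD('n))
            \<in> O[filtercomap (\<lambda>i. mesh_size (T i)) (at_right 0)](\<lambda>i. real (fun_space.dim (fe_space \<Omega> (T i))))"
    and degrees: "\<And>i. linear_degree_vector c\<^sub>p \<beta> \<sigma> (M i) (Y i) (p i)"
    and M_upper: "\<And>i. 2 * ((1 + \<epsilon>) * \<bar>ln (mesh_size (T i))\<bar> / (min s (\<beta> * b \<sigma>) * \<bar>ln \<sigma>\<bar>)) \<ge> real (M i)"
    and M_lower: "\<And>i. real (M i) \<ge> (1 + \<epsilon>) * \<bar>ln (mesh_size (T i))\<bar> / (min s (\<beta> * b \<sigma>) * \<bar>ln \<sigma>\<bar>)"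
    and Y_upper: "\<And>i. 2 * max (2 * \<bar>ln (mesh_size (T i))\<bar> / sqrt (lam 1)) 1 \<ge> Y i"
    and Y_lower: "\<And>i. Y i \<ge> max (2 * \<bar>ln (mesh_size (T i))\<bar> / sqrt (lam 1)) 1"
  shows "(\<lambda>i. real (fun_space.dim (tensor_space (fe_space \<Omega> (T i)) (hp_space \<sigma> (M i) (Y i) (p i)))))
            \<in> O[filtercomap (\<lambda>i. mesh_size (T i)) (at_right 0)](\<lambda>i. real (fun_space.dim (fe_space \<Omega> (T i))) *
                       (ln (real (fun_space.dim (fe_space \<Omega> (T i)))))\<^sup>2)"
proof -
  let ?h = "\<lambda>i. mesh_size (T i)"
  let ?F = "filtercomap ?h (at_right 0)"
  let ?N = "\<lambda>i. real (fun_space.dim (fe_space \<Omega> (T i)))"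
  define a where "a = (1 + \<epsilon>) / (min s (\<beta> * b \<sigma>) * \<bar>ln \<sigma>\<bar>)"
  define D where "D = 2 + c\<^sub>p * \<beta> * \<bar>ln \<sigma>\<bar>"
  have a: "a > 0" unfolding a_def using s \<sigma> \<beta> \<epsilon> b
    by (intro divide_pos_pos mult_pos_pos) auto
  have D: "D \<ge> 0" unfolding D_def using \<beta> c\<^sub>p by simp
  have h: "filterlim ?h (at_right 0) ?F" by (rule filterlim_filtercomap)
  have pos: "\<forall>\<^sub>F i in ?F. 0 < ?h i"
    using h eventually_at_right_less[of "0::real"] by (auto simp: filterlim_iff)
  have "1 \<le> CARD('n)" using dim by auto
  then have lnN: "\<forall>\<^sub>F i in ?F. 0 < ?N i \<and> \<bar>ln (?h i)\<bar> \<le> 2 * ln (?N i)"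
    by (intro eventually_abs_ln_le_ln[OF h _ _ N_lower]) auto
  \<comment> \<open>\<open>M \<le> 2 a \<bar>ln h\<bar> \<le> 4 a ln N\<close>; adding 1 only makes the constant positive.\<close>
  show ?thesis
  proof (rule landau_o.bigI)
    show "\<forall>\<^sub>F i in ?F. norm (real (fun_space.dim
              (tensor_space (fe_space \<Omega> (T i)) (hp_space \<sigma> (M i) (Y i) (p i)))))
            \<le> (D * (4 * a)\<^sup>2 + 1) * norm (?N i * (ln (?N i))\<^sup>2)"
      using pos lnN
    proof eventually_elim
      case (elim i)
      have "?h i < 1" using h_le[of i] by simp
      then have lnh: "\<bar>ln (?h i)\<bar> > 0" using elim by simp
      have Mlow: "a * \<bar>ln (?h i)\<bar> \<le> real (M i)" using M_lower[of i] by (simp add: a_def)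
      have "0 < a * \<bar>ln (?h i)\<bar>" using a lnh by (rule mult_pos_pos)
      then have M1: "1 \<le> M i" using Mlow by linarith
      have "real (M i) \<le> 2 * a * \<bar>ln (?h i)\<bar>" using M_upper[of i] by (simp add: a_def algebra_simps)
      also have "\<dots> \<le> 2 * a * (2 * ln (?N i))" using elim a by (intro mult_left_mono) auto
      finally have "(real (M i))\<^sup>2 \<le> (4 * a * ln (?N i))\<^sup>2" by (intro power_mono) auto
      then have Msq: "(real (M i))\<^sup>2 \<le> (4 * a)\<^sup>2 * (ln (?N i))\<^sup>2"
        by (simp add: power_mult_distrib)
      have "Y i > 0" using Y_lower[of i] by linarith
      then have "real (fun_space.dim
              (tensor_space (fe_space \<Omega> (T i)) (hp_space \<sigma> (M i) (Y i) (p i))))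
          \<le> ?N i * (D * (real (M i))\<^sup>2)"
        unfolding D_def using elim c\<^sub>p \<beta> \<sigma> M1
        by (intro dim_tensor_hp_space_le[OF _ degrees]) auto
      also have "\<dots> \<le> ?N i * (D * ((4 * a)\<^sup>2 * (ln (?N i))\<^sup>2))"
        using Msq D by (intro mult_left_mono) auto
      also have "\<dots> \<le> (D * (4 * a)\<^sup>2 + 1) * (?N i * (ln (?N i))\<^sup>2)"
        by (simp add: algebra_simps)
      finally show ?case by simp
    qed
    show "D * (4 * a)\<^sup>2 + 1 > 0"
      using D by (intro add_nonneg_pos mult_nonneg_nonneg) auto
  qed
qed

end
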